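(* Let $D=\mathbb F_q$ be the finite field with $q$ elements and consider the Coefficient-Choosing Game with parameters $\mathbb F_q$ and degree $d\ge 2$. (1) If $d\ge 4$ or $d=2$, the player who makes the last play has a winning strategy. (2) If $d=3$ and the characteristic of $\mathbb F_q$ is $3$, Wanda has a winning strategy (regardless of who is Player I). (3) If $d=3$ and the characteristic of $\mathbb F_q$ is not $3$, the player who makes the last play has a winning strategy.
   Context: The Coefficient-Choosing Game with parameters an integral domain $D$ and a degree $d\ge 2$: one of two players, Wanda or Nora, is designated Player I and the other Player II. Starting with Player I, the players alternately choose the coefficients $a_0,\dots,a_d\in D$ of a polynomial $f(x)=a_dx^d+\cdots+a_1x+a_0$; on each turn the player picks any not-yet-chosen index $i$ (the order is not predetermined) and a value $a_i\in D$, subject to the rule that $a_d\neq 0$ and $a_0\neq 0$. When all $d+1$ coefficients are chosen, Wanda wins if $f$ has a root in the field of fractions of $D$, and Nora wins otherwise. "A player wins" means that player has a strategy that wins no matter how the other plays. *)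

theory Defs
  imports
    "HOL-Computational_Algebra.Polynomial"
    "HOL-Computational_Algebra.Polynomial_Factorial"
begin

datatype player = Wanda | Nora

fun opponent :: "player \<Rightarrow> player" where
  "opponent Wanda = Nora"
| "opponent Nora = Wanda"

text \<open>A history lists, in chronological order, the pairs (index, value) chosen so far.\<close>

type_synonym 'a history = "(nat \<times> 'a) list"

text \<open>Turns are numbered from 0, so in degree \<open>d\<close> the last play is turn \<open>d\<close>.\<close>

definition mover :: "player \<Rightarrow> nat \<Rightarrow> player" where
  "mover first k = (if even k then first else opponent first)"

definition legal_move :: "nat \<Rightarrow> 'a::zero history \<Rightarrow> nat \<times> 'a \<Rightarrow> bool" where
  "legal_move d h m \<longleftrightarrow>
     fst m \<le> d \<and> fst m \<notin> fst ` set h \<and> (fst m = 0 \<or> fst m = d \<longrightarrow> snd m \<noteq> 0)"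

definition legal_history :: "nat \<Rightarrow> 'a::zero history \<Rightarrow> bool" where
  "legal_history d h \<longleftrightarrow> (\<forall>k<length h. legal_move d (take k h) (h ! k))"

definition complete_play :: "nat \<Rightarrow> 'a::zero history \<Rightarrow> bool" where
  "complete_play d h \<longleftrightarrow> legal_history d h \<and> length h = d + 1"

definition poly_of_play :: "'a::comm_monoid_add history \<Rightarrow> 'a poly" where
  "poly_of_play h = (\<Sum>(i, a)\<leftarrow>h. monom a i)"

definition has_root_in_fract :: "'a::idom poly \<Rightarrow> bool" where
  "has_root_in_fract f \<longleftrightarrow> (\<exists>x :: 'a fract. poly (map_poly to_fract f) x = 0)"

fun wins_play :: "player \<Rightarrow> 'a::idom history \<Rightarrow> bool" where
  "wins_play Wanda h \<longleftrightarrow> has_root_in_fract (poly_of_play h)"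
| "wins_play Nora h \<longleftrightarrow> \<not> has_root_in_fract (poly_of_play h)"

type_synonym 'a strategy = "'a history \<Rightarrow> nat \<times> 'a"

definition follows :: "player \<Rightarrow> player \<Rightarrow> 'a strategy \<Rightarrow> 'a history \<Rightarrow> bool" where
  "follows first p \<sigma> h \<longleftrightarrow> (\<forall>k<length h. mover first k = p \<longrightarrow> h ! k = \<sigma> (take k h))"

text \<open>The first conjunct makes the strategy prescribe a legal move in every position it can
  lead to; without it, a strategy that breaks the rules would win vacuously.\<close>

definition winning_strategy ::
    "nat \<Rightarrow> player \<Rightarrow> player \<Rightarrow> 'a::idom strategy \<Rightarrow> bool" where
  "winning_strategy d first p \<sigma> \<longleftrightarrow>
     (\<forall>h. legal_history d h \<and> follows first p \<sigma> h \<and> length h \<le> d \<and> mover first (length h) = p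
        \<longrightarrow> legal_move d h (\<sigma> h)) \<and>
     (\<forall>h. complete_play d h \<and> follows first p \<sigma> h \<longrightarrow> wins_play p h)"

text \<open>The type argument is the integral domain from which the coefficients are chosen.\<close>

definition has_winning_strategy ::
    "'a::idom itself \<Rightarrow> nat \<Rightarrow> player \<Rightarrow> player \<Rightarrow> bool" where
  "has_winning_strategy _ d first p \<longleftrightarrow> (\<exists>\<sigma> :: 'a strategy. winning_strategy d first p \<sigma>)"

end

theory Submission
  imports Defs
begin

text \<open>
  If Wanda moves last, she keeps \<open>f 1 = 0\<close>: she answers a coefficient \<open>a\<close> by \<open>- a\<close>, pairing the
  index 0 with \<open>d\<close> and the middle indices with each other, after first setting a middle
  coefficient to 0 when \<open>d\<close> is even.

  If Nora moves last and a middle coefficient is left, its \<open>q\<close> possible values outnumber the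
  \<open>q - 1\<close> nonzero candidates for a root, so she wins; for \<open>d \<ge> 4\<close> she has time to get both extreme
  coefficients out of the way. If an extreme coefficient is left, she fails only if the other
  coefficients define a permutation of the nonzero elements (directly, or after inverting \<open>x\<close>).
  For \<open>d = 2\<close> she avoids this by first setting the middle coefficient to 1. For \<open>d = 3\<close> she makes
  exactly one middle coefficient vanish: outside characteristic 3 the cubic \<open>a x\<^sup>3 + c x\<close> with
  \<open>a, c \<noteq> 0\<close> is not injective. In characteristic 3 it is additive, and injective when \<open>- c / a\<close> is
  not a nonzero square, which lets Wanda win even if Nora moves last.
\<close>

section \<open>Winning positions\<close>

abbreviation indices :: "'a history \<Rightarrow> nat set" where
  "indices h \<equiv> fst ` set h"

abbreviation play_val :: "'a::comm_semiring_1 history \<Rightarrow> 'a \<Rightarrow> 'a" where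
  "play_val h \<equiv> poly (poly_of_play h)"

text \<open>Backward induction over the game tree, so that wins can be argued move by move without
  writing down a strategy. Legality of \<open>h\<close> itself is tracked separately by
  \<open>legal_history\<close>.\<close>

inductive winning :: "nat \<Rightarrow> player \<Rightarrow> player \<Rightarrow> 'a::idom history \<Rightarrow> bool"
  for d :: nat and first p :: player where
  final: "length h = Suc d \<Longrightarrow> wins_play p h \<Longrightarrow> winning d first p h"
| own: "length h \<le> d \<Longrightarrow> mover first (length h) = p \<Longrightarrow> legal_move d h m
    \<Longrightarrow> winning d first p (h @ [m]) \<Longrightarrow> winning d first p h"
| other: "length h \<le> d \<Longrightarrow> mover first (length h) \<noteq> p
    \<Longrightarrow> (\<And>m. legal_move d h m \<Longrightarrow> winning d first p (h @ [m])) \<Longrightarrow> winning d first p h"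

lemma mover_Suc [simp]: "mover first (Suc k) = opponent (mover first k)"
  by (cases first) (auto simp: mover_def)

lemma opponent_eq_iff: "opponent a = b \<longleftrightarrow> a \<noteq> b"
  by (cases a; cases b) auto

lemma mover_eq_iff: "mover first k = mover first l \<longleftrightarrow> even (k + l)"
  by (cases first) (auto simp: mover_def)

lemma legal_history_snoc [simp]:
  "legal_history d (h @ [m]) \<longleftrightarrow> legal_history d h \<and> legal_move d h m"
  unfolding legal_history_def by (auto simp: less_Suc_eq nth_append)

lemma legal_history_snoc2 [simp]:
  "legal_history d (h @ [m, m']) \<longleftrightarrow>
     legal_history d h \<and> legal_move d h m \<and> legal_move d (h @ [m]) m'"
  using legal_history_snoc[of d "h @ [m]" m'] by simp

lemma legal_history_Nil [simp]: "legal_history d []"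
  by (simp add: legal_history_def)

lemma follows_snoc:
  "follows first p \<sigma> (h @ [m]) \<longleftrightarrow>
     follows first p \<sigma> h \<and> (mover first (length h) = p \<longrightarrow> m = \<sigma> h)"
  unfolding follows_def by (auto simp: less_Suc_eq nth_append)

text \<open>By choice, \<open>\<sigma>\<close> picks some legal move that keeps the position
  winning. Every legal play that follows \<open>\<sigma>\<close> then runs through winning positions
  only, up to a final one.\<close>

lemma winning_imp_has_winning_strategy:
  assumes "winning d first p ([] :: 'a::idom history)"
  shows "has_winning_strategy TYPE('a) d first p"
proof -
  define \<sigma> :: "'a strategy" where
    "\<sigma> h = (SOME m. legal_move d h m \<and> winning d first p (h @ [m]))" for h
  have \<sigma>: "legal_move d h (\<sigma> h) \<and> winning d first p (h @ [\<sigma> h])"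
    if "winning d first p h" "length h \<le> d" "mover first (length h) = p" for h
  proof -
    from that(1) have "\<exists>m. legal_move d h m \<and> winning d first p (h @ [m])"
    proof cases
      case (own m)
      then show ?thesis by blast
    qed (use that in simp_all)
    then show ?thesis unfolding \<sigma>_def by (rule someI_ex)
  qed
  have reach: "winning d first p h"
    if "legal_history d h" "follows first p \<sigma> h" "length h \<le> Suc d" for h
    using that
  proof (induction h rule: rev_induct)
    case Nil
    then show ?case using assms by simp
  next
    case (snoc m h)
    then have w: "winning d first p h" and m: "legal_move d h m" and len: "length h \<le> d"
      and f: "mover first (length h) = p \<longrightarrow> m = \<sigma> h"
      by (auto simp: follows_snoc)
    show ?case
    proof (cases "mover first (length h) = p")
      case True
      then show ?thesis using \<sigma>[OF w len] f by simp
    next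
      case False
      from w show ?thesis by cases (use False len m in simp_all)
    qed
  qed
  have "winning_strategy d first p \<sigma>"
    unfolding winning_strategy_def
  proof (intro conjI allI impI; elim conjE)
    fix h assume "legal_history d h" "follows first p \<sigma> h" "length h \<le> d"
      "mover first (length h) = p"
    then show "legal_move d h (\<sigma> h)" using \<sigma> reach by simp
  next
    fix h :: "'a history" assume "complete_play d h" and f: "follows first p \<sigma> h"
    then have "legal_history d h" "length h = Suc d" by (auto simp: complete_play_def)
    with reach[OF _ f] have "winning d first p h" by simp
    then show "wins_play p h" by cases (use \<open>length h = Suc d\<close> in simp_all)
  qed
  then show ?thesis unfolding has_winning_strategy_def by blast
qed

section \<open>Counting played and open indices\<close>

lemma legal_history_distinct: "legal_history d h \<Longrightarrow> distinct (map fst h)"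
  by (induction h rule: rev_induct) (auto simp: legal_move_def)

lemma legal_history_indices: "legal_history d h \<Longrightarrow> indices h \<subseteq> {..d}"
  by (induction h rule: rev_induct) (auto simp: legal_move_def)

lemma card_indices: "legal_history d h \<Longrightarrow> card (indices h) = length h"
  using distinct_card[of "map fst h"] legal_history_distinct[of d h] by simp

lemma card_unplayed:
  assumes "legal_history d h"
  shows "card ({..d} - indices h) = Suc d - length h"
  using assms card_Diff_subset[OF _ legal_history_indices[OF assms]]
  by (simp add: card_indices)

lemma legal_history_length: "legal_history d h \<Longrightarrow> length h \<le> Suc d"
  using card_mono[OF _ legal_history_indices[of d h]] by (simp add: card_indices)

lemma ex_unplayed:
  assumes "legal_history d h" "length h \<le> d"
  obtains i where "i \<le> d" "i \<notin> indices h"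
proof -
  have "card ({..d} - indices h) \<noteq> 0" using assms by (simp add: card_unplayed)
  then have "{..d} - indices h \<noteq> {}" by (metis card.empty)
  then show ?thesis using that by blast
qed

lemma complete_indices:
  assumes "legal_history d h" "length h = Suc d"
  shows "indices h = {..d}"
  by (rule card_subset_eq) (use assms in \<open>auto simp: card_indices dest: legal_history_indices\<close>)

lemma ex_legal_move:
  assumes "legal_history d (h :: 'a::idom history)" "length h \<le> d"
  obtains m where "legal_move d h m"
proof -
  obtain i where "i \<le> d" "i \<notin> indices h" using ex_unplayed[OF assms] .
  then have "legal_move d h (i, 1)" by (simp add: legal_move_def)
  then show ?thesis by (rule that)
qed

text \<open>For use when it does not matter whose turn it is. If the turn is that of
  \<open>p\<close>, some legal move must exist, which \<open>ex_legal_move\<close> provides.\<close>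

lemma winning_any_move:
  assumes "legal_history d h" "length h \<le> d"
    and "\<And>m. legal_move d h m \<Longrightarrow> winning d first p (h @ [m])"
  shows "winning d first p h"
  using assms ex_legal_move[OF assms(1,2)] winning.own winning.other by metis

section \<open>The polynomial of a history and its roots\<close>

lemma poly_of_play_Nil [simp]: "poly_of_play [] = 0"
  by (simp add: poly_of_play_def)

lemma poly_of_play_Cons [simp]: "poly_of_play ((i, a) # h) = monom a i + poly_of_play h"
  by (simp add: poly_of_play_def)

lemma poly_of_play_append [simp]: "poly_of_play (h @ h') = poly_of_play h + poly_of_play h'"
  by (simp add: poly_of_play_def)

lemma play_val_snoc: "play_val (h @ [(i, a)]) x = play_val h x + a * x ^ i"
  by (simp add: poly_monom)

text \<open>The value at 0 is the constant coefficient, which the rules force to be nonzero. Hence 0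
  is never a root of a completed play.\<close>

lemma play_val_0_eq_0_iff: "legal_history d h \<Longrightarrow> play_val h 0 = 0 \<longleftrightarrow> 0 \<notin> indices h"
proof (induction h rule: rev_induct)
  case (snoc m h)
  obtain i a where "m = (i, a)" by fastforce
  with snoc show ?case by (cases "i = 0") (auto simp: legal_move_def poly_monom power_0_left)
qed simp

lemma poly_fract_poly: "poly (map_poly to_fract f) (to_fract x) = to_fract (poly f x)"
  by (induction f) (simp_all add: map_poly_pCons)

text \<open>A field is its own field of fractions: \<open>Fract a b\<close> is the image of
  \<open>a / b\<close>.\<close>

lemma has_root_in_fract_field:
  fixes f :: "'a::field poly"
  shows "has_root_in_fract f \<longleftrightarrow> (\<exists>x. poly f x = 0)"
proof
  assume "has_root_in_fract f"
  then obtain x where x: "poly (map_poly to_fract f) x = 0" by (auto simp: has_root_in_fract_def)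
  obtain a b where "x = Fract a b" "b \<noteq> 0" by (cases x) auto
  then have "x = to_fract (a / b)" by (simp add: to_fract_def eq_fract)
  with x show "\<exists>x. poly f x = 0" by (auto simp: poly_fract_poly)
next
  assume "\<exists>x. poly f x = 0"
  then obtain x where "poly f x = 0" ..
  then have "poly (map_poly to_fract f) (to_fract x) = 0" by (simp add: poly_fract_poly)
  then show "has_root_in_fract f" unfolding has_root_in_fract_def ..
qed

section \<open>Wanda moves last\<close>

text \<open>The hypotheses on \<open>h\<close> form the invariant of the pairing: the parity says
  that Nora is to move or the game is over, 1 is a root so far, and the two extreme indices are both
  open or both played.\<close>

lemma Wanda_mirrors:
  fixes h :: "'a::field history"
  assumes "d \<ge> 2" "mover first d = Wanda" "legal_history d h" "odd (d + length h)"
    and "play_val h 1 = 0" "0 \<in> indices h \<longleftrightarrow> d \<in> indices h"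
  shows "winning d first Wanda h"
  using assms(3-)
proof (induction "Suc d - length h" arbitrary: h rule: less_induct)
  case less
  note len = legal_history_length[OF less.prems(1)]
  show ?case
  proof (cases "length h = Suc d")
    case True
    show ?thesis
      by (rule winning.final) (use True less.prems in \<open>auto simp: has_root_in_fract_field\<close>)
  next
    case False
    with len have len': "length h \<le> d" by simp
    with less.prems(2) have len'': "length h < d" by (cases "length h = d") auto
    have "mover first (length h) \<noteq> mover first d"
      using less.prems(2) by (simp add: mover_eq_iff add.commute)
    then have turn: "mover first (length h) \<noteq> Wanda" using assms(2) by simp
    show ?thesis
    proof (rule winning.other[OF len' turn])
      fix m assume m: "legal_move d h m"
      obtain i a where ia: "m = (i, a)" by fastforce
      let ?h = "h @ [m]"
      have leg: "legal_history d ?h" using less.prems m by simp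
      \<comment> \<open>Answering \<open>a\<close> by \<open>- a\<close> restores the value 0 at 1,
        so only the index \<open>j\<close> of the answer has to be found in each case.\<close>
      have reply: "winning d first Wanda ?h"
        if "legal_move d ?h (j, - a)"
          "0 \<in> insert j (insert i (indices h)) \<longleftrightarrow> d \<in> insert j (insert i (indices h))" for j
      proof (rule winning.own)
        show "length ?h \<le> d" using len'' by simp
        show "mover first (length ?h) = Wanda" using turn by (simp add: opponent_eq_iff)
        show "legal_move d ?h (j, - a)" by fact
        show "winning d first Wanda (?h @ [(j, - a)])"
        proof (rule less.hyps)
          show "Suc d - length (?h @ [(j, - a)]) < Suc d - length h" using len'' by simp
          show "legal_history d (?h @ [(j, - a)])" using leg that by (simp only: legal_history_snoc)
          show "odd (d + length (?h @ [(j, - a)]))" using less.prems by simp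
          show "play_val (?h @ [(j, - a)]) 1 = 0" using less.prems ia by (simp add: poly_monom)
          show "(0 \<in> indices (?h @ [(j, - a)])) = (d \<in> indices (?h @ [(j, - a)]))"
            using that ia by (auto simp: image_iff)
        qed
      qed
      show "winning d first Wanda ?h"
      proof (cases "i = 0 \<or> i = d")
        case True
        then show ?thesis
        proof
          assume "i = 0"
          then show ?thesis
            by (intro reply[of d]) (use m ia less.prems assms(1) in \<open>simp_all add: legal_move_def\<close>)
        next
          assume "i = d"
          then show ?thesis
            by (intro reply[of 0]) (use m ia less.prems assms(1) in \<open>simp_all add: legal_move_def\<close>)
        qed
      next
        case False
        \<comment> \<open>After Nora's move the number of open indices is odd. Without an open
          middle index it would be 0 or 2, because the extremes are open together or not at
          all.\<close>
        have "\<exists>j. 0 < j \<and> j < d \<and> j \<notin> indices ?h"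
        proof (rule ccontr)
          assume all: "\<not> ?thesis"
          define U where "U = {..d} - indices ?h"
          have "U \<subseteq> {0, d}"
          proof
            fix x assume x: "x \<in> U"
            then have "\<not> (0 < x \<and> x < d)" using all unfolding U_def by blast
            then show "x \<in> {0, d}" using x by (auto simp: U_def)
          qed
          moreover have "0 \<in> U \<longleftrightarrow> d \<in> U"
            using less.prems False ia by (simp add: U_def)
          ultimately have "U = {} \<or> U = {0, d}" by blast
          then have "card U = 0 \<or> card U = 2"
            using assms(1) by auto
          then have "Suc d - length ?h = 0 \<or> Suc d - length ?h = 2"
            unfolding U_def card_unplayed[OF leg] .
          then have "d = Suc (Suc (length h))" using len'' by auto
          then show False using less.prems(2) by auto
        qed
        then obtain j where "0 < j" "j < d" "j \<notin> indices ?h" by blast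
        then show ?thesis
          using False less.prems ia by (intro reply[of j]) (auto simp: legal_move_def)
      qed
    qed
  qed
qed

lemma Wanda_last_wins:
  assumes "d \<ge> 2" "mover first d = Wanda"
  shows "winning d first Wanda ([] :: 'a::field history)"
proof (cases "even d")
  case True
  then have "mover first 0 = Wanda" using assms(2) by (simp add: mover_def)
  show ?thesis
  \<comment> \<open>The value 0 at a middle index keeps the root 1 and hands the turn to Nora with
    an even number of open indices.\<close>
  proof (rule winning.own[where m = "(1, 0)"])
    show "winning d first Wanda ([] @ [(1, 0 :: 'a)])"
      by (rule Wanda_mirrors)
        (use True assms play_val_snoc[of "[]" 1 0] in \<open>auto simp: legal_move_def legal_history_def\<close>)
  qed (use assms \<open>mover first 0 = Wanda\<close> in \<open>auto simp: legal_move_def\<close>)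
qed (use assms Wanda_mirrors[of d first "[]"] in auto)

section \<open>Nora moves last\<close>

text \<open>The root 0 is already excluded by the nonzero constant coefficient, so only nonzero
  \<open>x\<close> need checking.\<close>

lemma Nora_final_move:
  fixes h :: "'a::field history"
  assumes "mover first d = Nora" "legal_history d h" "length h = d"
    and m: "legal_move d h (i, a)" and nz: "\<And>x. x \<noteq> 0 \<Longrightarrow> play_val h x + a * x ^ i \<noteq> 0"
  shows "winning d first Nora h"
proof (rule winning.own[OF _ _ m])
  have leg: "legal_history d (h @ [(i, a)])" using assms by simp
  have "0 \<in> indices (h @ [(i, a)])"
    using complete_indices[OF leg] assms(3) by (simp only: length_append) simp
  then have "play_val (h @ [(i, a)]) x \<noteq> 0" for x
    using play_val_0_eq_0_iff[OF leg] nz[of x] unfolding play_val_snoc by (cases "x = 0") auto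
  then show "winning d first Nora (h @ [(i, a)])"
    using assms(3) by (intro winning.final) (auto simp: has_root_in_fract_field)
qed (use assms in auto)

text \<open>Each nonzero \<open>x\<close> is a root for exactly one value of the last coefficient;
  this turns Nora's final choice into counting.\<close>

lemma eq_neg_div_iff:
  fixes x :: "'a::field"
  assumes "x \<noteq> 0"
  shows "v + a * x ^ i = 0 \<longleftrightarrow> a = - v / x ^ i"
  using assms by (auto simp: field_simps eq_neg_iff_add_eq_0 add.commute)

lemma Nora_final_middle:
  fixes h :: "'a::{finite,field} history"
  assumes "mover first d = Nora" "legal_history d h" "length h = d"
    and "0 \<in> indices h" "d \<in> indices h"
  shows "winning d first Nora h"
proof -
  obtain i where i: "i \<le> d" "i \<notin> indices h" using ex_unplayed assms(2,3) by blast
  \<comment> \<open>\<open>?I\<close> collects the values that would create a nonzero root. The open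
    index is a middle one, so every value outside \<open>?I\<close> is legal, even 0.\<close>
  let ?I = "(\<lambda>x. - play_val h x / x ^ i) ` (UNIV - {0})"
  have "card ?I < card (UNIV :: 'a set)"
    using card_image_le[of "UNIV - {0 :: 'a}" "\<lambda>x. - play_val h x / x ^ i"]
    by (simp add: card_Diff_subset) (metis One_nat_def Suc_pred finite_UNIV_card_ge_0 finite le_imp_less_Suc)
  then have "?I \<noteq> UNIV" by auto
  then obtain a where "a \<notin> ?I" by blast
  then show ?thesis
    using i assms by (intro Nora_final_move[of first d h i a]) (auto simp: legal_move_def eq_neg_div_iff)
qed

text \<open>If every nonzero value \<open>a\<close> gives a root, then the map sending \<open>x \<noteq> 0\<close> to the value of \<open>a\<close>
  for which \<open>x\<close> is a root permutes the nonzero elements.\<close>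

lemma Nora_final_extreme:
  fixes h :: "'a::{finite,field} history"
  assumes "mover first d = Nora" "legal_history d h" "length h = d"
    and "i \<le> d" "i \<notin> indices h"
    and "(\<exists>x. x \<noteq> 0 \<and> play_val h x = 0) \<or>
      (\<exists>x y. x \<noteq> 0 \<and> y \<noteq> 0 \<and> x \<noteq> y \<and> play_val h x / x ^ i = play_val h y / y ^ i)"
  shows "winning d first Nora h"
proof -
  let ?\<phi> = "\<lambda>x. - play_val h x / x ^ i" and ?U = "UNIV - {0 :: 'a}"
  have "\<not> ?U \<subseteq> ?\<phi> ` ?U"
  proof
    assume sub: "?U \<subseteq> ?\<phi> ` ?U"
    have "card (?\<phi> ` ?U) \<le> card ?U" by (rule card_image_le) simp
    then have eq: "?\<phi> ` ?U = ?U" using sub by (metis card_seteq finite)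
    then have "inj_on ?\<phi> ?U" by (intro eq_card_imp_inj_on) auto
    \<comment> \<open>Injectivity rules out the second alternative of the last assumption; the first
      would put 0 into the image.\<close>
    then have "\<not> (\<exists>x y. x \<noteq> 0 \<and> y \<noteq> 0 \<and> x \<noteq> y \<and> play_val h x / x ^ i = play_val h y / y ^ i)"
      by (auto simp: inj_on_def)
    with assms(6) obtain x where "x \<noteq> 0" "play_val h x = 0" by blast
    then have "0 \<in> ?\<phi> ` ?U" by (intro image_eqI[of _ _ x]) auto
    with eq show False by blast
  qed
  then obtain a where "a \<noteq> 0" "a \<notin> ?\<phi> ` ?U" by blast
  then show ?thesis
    using assms by (intro Nora_final_move[of first d h i a]) (auto simp: legal_move_def eq_neg_div_iff)
qed

text \<open>All open indices are middle ones, so intermediate moves by either player are harmless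
  and \<open>Nora_final_middle\<close> decides the last turn.\<close>

lemma Nora_extremes_played:
  fixes h :: "'a::{finite,field} history"
  assumes "mover first d = Nora"
    and "legal_history d h" "length h \<le> d" "0 \<in> indices h" "d \<in> indices h"
  shows "winning d first Nora h"
  using assms(2-)
proof (induction "d - length h" arbitrary: h rule: less_induct)
  case less
  show ?case
  proof (cases "length h = d")
    case True
    then show ?thesis using Nora_final_middle assms(1) less.prems by blast
  next
    case False
    show ?thesis
    proof (rule winning_any_move)
      fix m assume "legal_move d h m"
      then show "winning d first Nora (h @ [m])"
        using less.prems False by (intro less.hyps) auto
    qed (use less.prems in auto)
  qed
qed

text \<open>Nora at once takes whichever extreme index is still open. The strict bound on the length
  ensures that her last turn is still to come.\<close>

lemma Nora_one_extreme_played: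
  fixes h :: "'a::{finite,field} history"
  assumes "mover first d = Nora" "mover first (length h) = Nora"
    and "legal_history d h" "length h < d" "0 \<in> indices h \<or> d \<in> indices h"
  shows "winning d first Nora h"
proof (cases "0 \<in> indices h \<and> d \<in> indices h")
  case False
  then obtain i where i: "i = 0 \<or> i = d" "i \<notin> indices h" by blast
  then have m: "legal_move d h (i, 1)" by (auto simp: legal_move_def)
  show ?thesis
  proof (rule winning.own[OF _ _ m])
    show "winning d first Nora (h @ [(i, 1)])"
      by (rule Nora_extremes_played) (use assms i m in auto)
  qed (use assms in auto)
qed (use Nora_extremes_played[OF assms(1,3)] assms(4) in simp)

text \<open>Nora takes index 0 and, after Wanda's answer, the index \<open>d\<close> if it is still
  open. The bound leaves her last turn after both of these.\<close>

lemma Nora_no_extreme_played: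
  fixes h :: "'a::{finite,field} history"
  assumes "mover first d = Nora" "mover first (length h) = Nora"
    and "legal_history d h" "length h + 4 \<le> d"
  shows "winning d first Nora h"
proof (cases "0 \<in> indices h \<or> d \<in> indices h")
  case False
  then have m: "legal_move d h (0, 1)" by (auto simp: legal_move_def)
  show ?thesis
  proof (rule winning.own[OF _ _ m])
    show "winning d first Nora (h @ [(0, 1)])"
    proof (rule winning.other)
      fix m' assume "legal_move d (h @ [(0, 1)]) m'"
      then show "winning d first Nora ((h @ [(0, 1)]) @ [m'])"
        using assms m by (intro Nora_one_extreme_played) (auto simp: opponent_eq_iff)
    qed (use assms in \<open>auto simp: opponent_eq_iff\<close>)
  qed (use assms in auto)
qed (use Nora_one_extreme_played[OF assms(1-3)] assms(4) in simp)

lemma Nora_last_wins: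
  assumes "d \<ge> 4" "mover first d = Nora"
  shows "winning d first Nora ([] :: 'a::{finite,field} history)"
proof (cases "even d")
  case True
  then show ?thesis using assms by (intro Nora_no_extreme_played) (auto simp: mover_def)
next
  case False
  \<comment> \<open>The stronger bound makes \<open>length h + 4 \<le> d\<close> hold even after
    Wanda's opening move.\<close>
  with assms(1) have "d \<ge> 5" by (cases "d = 4") auto
  show ?thesis
  proof (rule winning.other)
    fix m :: "nat \<times> 'a" assume "legal_move d [] m"
    then show "winning d first Nora ([] @ [m])"
      using False assms \<open>d \<ge> 5\<close>
      by (intro Nora_no_extreme_played) (auto simp: mover_def legal_history_def)
  qed (use False assms in \<open>cases first; auto simp: mover_def\<close>)+
qed

lemma Nora_last_wins_2:
  assumes "mover first 2 = Nora"
  shows "winning 2 first Nora ([] :: 'a::{finite,field} history)"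
proof (rule winning.own[where m = "(1, 1)"])
  have first: "first = Nora" using assms by (simp add: mover_def)
  show "winning 2 first Nora ([] @ [(1, 1 :: 'a)])"
  proof (rule winning.other)
    fix m :: "nat \<times> 'a" assume m: "legal_move 2 ([] @ [(1, 1)]) m"
    obtain i a where ia: "m = (i, a)" by fastforce
    with m have i: "i = 0 \<or> i = 2" and a: "a \<noteq> 0" by (auto simp: legal_move_def)
    let ?h = "([] @ [(1, 1)]) @ [(i, a)]"
    have leg: "legal_history 2 ?h"
      unfolding legal_history_snoc using m ia by (auto simp: legal_move_def)
    \<comment> \<open>Wanda must now play an extreme coefficient, leaving \<open>x + a\<close> with
      root \<open>- a\<close>, or \<open>a * x ^ 2 + x\<close> with root \<open>- 1 / a\<close>.
      Either way \<open>Nora_final_extreme\<close> applies.\<close>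
    have "\<exists>x. x \<noteq> 0 \<and> play_val ?h x = 0"
      unfolding play_val_snoc using i a
      by (elim disjE; intro exI[of _ "if i = 0 then - a else - 1 / a"]) (auto simp: power2_eq_square)
    then have "winning 2 first Nora ?h"
      by (intro Nora_final_extreme[where i = "2 - i"]) (use assms leg i in auto)
    then show "winning 2 first Nora (([] @ [(1, 1)]) @ [m])" using ia by simp
  qed (use first in \<open>auto simp: mover_def\<close>)
qed (use assms in \<open>auto simp: mover_def legal_move_def\<close>)

section \<open>Cubics\<close>

text \<open>Squaring is at most two-to-one, and only 0 squares to 0. Treating 0 separately gives the
  strict inequality.\<close>

lemma card_UNIV_less_twice_squares:
  "card (UNIV :: 'a::{finite,field} set) < 2 * card (range (\<lambda>x :: 'a. x ^ 2))"
proof -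
  let ?S = "range (\<lambda>x :: 'a. x ^ 2)"
  have fib: "card {x :: 'a. x ^ 2 = s} \<le> 2" for s
  proof (cases "\<exists>r. s = r ^ 2")
    case True
    then obtain r where "s = r ^ 2" ..
    then have "{x :: 'a. x ^ 2 = s} \<subseteq> {r, - r}" by (auto simp: power2_eq_iff)
    then have "card {x :: 'a. x ^ 2 = s} \<le> card {r, - r}" by (intro card_mono) auto
    also have "\<dots> \<le> 2" by (simp add: card_insert_if)
    finally show ?thesis .
  next
    case False
    then have "{x :: 'a. x ^ 2 = s} = {}" by auto
    then show ?thesis by (metis card.empty zero_le)
  qed
  have "(UNIV :: 'a set) \<subseteq> insert 0 (\<Union>s\<in>?S - {0}. {x. x ^ 2 = s})" by auto
  then have "card (UNIV :: 'a set) \<le> card (insert 0 (\<Union>s\<in>?S - {0}. {x. x ^ 2 = s}))"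
    by (intro card_mono) auto
  also have "\<dots> \<le> Suc (card (\<Union>s\<in>?S - {0}. {x. x ^ 2 = s}))"
    by (simp add: card_insert_if)
  also have "card (\<Union>s\<in>?S - {0}. {x. x ^ 2 = s}) \<le> (\<Sum>s\<in>?S - {0}. card {x. x ^ 2 = s})"
    by (rule card_UN_le) simp
  also have "\<dots> \<le> (\<Sum>s\<in>?S - {0}. 2)" by (intro sum_mono fib)
  also have "\<dots> = 2 * card (?S - {0})" by simp
  also have "card (?S - {0}) = card ?S - 1" by (subst card_Diff_singleton) (auto intro: image_eqI[of _ _ 0])
  finally have "card (UNIV :: 'a set) \<le> Suc (2 * (card ?S - 1))" by simp
  moreover have "card ?S > 0" by (simp add: card_gt_0_iff)
  ultimately show ?thesis by linarith
qed

text \<open>Pigeonhole: the squares \<open>v ^ 2\<close> and the elements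
  \<open>e - b * u ^ 2\<close> each fill more than half of the field, so they meet.\<close>

lemma ex_square_plus_mult_square:
  fixes b e :: "'a::{finite,field}"
  assumes "b \<noteq> 0"
  shows "\<exists>u v. b * u ^ 2 + v ^ 2 = e"
proof -
  let ?S = "range (\<lambda>x :: 'a. x ^ 2)"
  let ?T = "(\<lambda>s. e - b * s) ` ?S"
  have "card ?T = card ?S" by (rule card_image) (use assms in \<open>auto simp: inj_on_def\<close>)
  moreover have "card (?S \<union> ?T) \<le> card (UNIV :: 'a set)" by (rule card_mono) auto
  ultimately have "?S \<inter> ?T \<noteq> {}"
    using card_UNIV_less_twice_squares[where 'a = 'a] card_Un_disjoint[of ?S ?T] by fastforce
  then obtain u v where "v ^ 2 = e - b * u ^ 2" by blast
  then have "b * u ^ 2 + v ^ 2 = e" by simp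
  then show ?thesis by blast
qed

text \<open>In characteristic 2 squaring is injective, since \<open>- x = x\<close>, and hence
  surjective on a finite field.\<close>

lemma ex_sqrt_char2:
  fixes c :: "'a::{finite,field}"
  assumes "(2 :: 'a) = 0"
  shows "\<exists>s. s ^ 2 = c"
proof -
  have "- x = x" for x :: 'a
    using assms by (metis add_eq_0_iff mult_2 mult_zero_left)
  then have "inj (\<lambda>x :: 'a. x ^ 2)" by (auto simp: inj_on_def power2_eq_iff)
  then have "surj (\<lambda>x :: 'a. x ^ 2)" by (rule finite_UNIV_inj_surj[rotated]) simp
  then show ?thesis by (metis surjD)
qed

text \<open>Dividing the difference of the two values by \<open>x - y\<close> leaves
  \<open>x ^ 2 + x * y + y ^ 2 + c\<close>; a zero of this with \<open>x \<noteq> y\<close> is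
  wanted.\<close>

lemma cubic_not_inj_monic:
  fixes c :: "'a::{finite,field}"
  assumes "(3 :: 'a) \<noteq> 0" "c \<noteq> 0"
  shows "\<exists>x y. x \<noteq> y \<and> x ^ 3 + c * x = y ^ 3 + c * y"
proof (cases "(2 :: 'a) = 0")
  case True
  \<comment> \<open>With \<open>y = 0\<close> the condition becomes
    \<open>x ^ 2 = - c\<close>.\<close>
  obtain s where "s ^ 2 = - c" using ex_sqrt_char2[OF True] by blast
  then have "s \<noteq> 0" "s ^ 3 + c * s = 0 ^ 3 + c * 0"
    using assms by (auto simp: power3_eq_cube power2_eq_square)
  then show ?thesis by blast
next
  case False
  txt \<open>The substitution \<open>x = u + v\<close>, \<open>y = u - v\<close> turns \<open>x\<^sup>2 + x y + y\<^sup>2\<close> into \<open>3 u\<^sup>2 + v\<^sup>2\<close>.\<close>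
  obtain u v where uv: "3 * u ^ 2 + v ^ 2 = - c"
    using ex_square_plus_mult_square[OF assms(1)] by blast
  show ?thesis
  proof (cases "v = 0")
    case True
    txt \<open>The cubic minus its value at \<open>u\<close> has the double root \<open>u\<close> and the simple root \<open>- 2 u\<close>.\<close>
    with uv have c: "c = - (3 * u ^ 2)" by simp
    with assms have "u \<noteq> 0" by auto
    then have "u \<noteq> - 2 * u" using assms(1) by (auto simp: eq_neg_iff_add_eq_0 algebra_simps)
    moreover have "u ^ 3 + c * u = (- 2 * u) ^ 3 + c * (- 2 * u)"
      unfolding c by (simp add: power2_eq_square power3_eq_cube algebra_simps)
    ultimately show ?thesis by blast
  next
    case v: False
    have c: "c = - (3 * u ^ 2 + v ^ 2)" using uv by simp
    have "(u + v) - (u - v) = 2 * v" by simp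
    then have "u + v \<noteq> u - v" using v False by auto
    moreover have "(u + v) ^ 3 + c * (u + v) = (u - v) ^ 3 + c * (u - v)"
      unfolding c by (simp add: power2_eq_square power3_eq_cube algebra_simps)
    ultimately show ?thesis by blast
  qed
qed

text \<open>The form needed for \<open>Nora_final_extreme\<close>: a collision with the point 0
  gives a nonzero root, any other one a collision of nonzero points.\<close>

lemma cubic_not_inj:
  fixes a c :: "'a::{finite,field}"
  assumes "(3 :: 'a) \<noteq> 0" "a \<noteq> 0" "c \<noteq> 0"
  shows "(\<exists>x. x \<noteq> 0 \<and> a * x ^ 3 + c * x = 0) \<or>
    (\<exists>x y. x \<noteq> 0 \<and> y \<noteq> 0 \<and> x \<noteq> y \<and> a * x ^ 3 + c * x = a * y ^ 3 + c * y)"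
proof -
  obtain x y where xy: "x \<noteq> y" "x ^ 3 + c / a * x = y ^ 3 + c / a * y"
    using cubic_not_inj_monic[of "c / a"] assms by auto
  from xy(2) have "a * (x ^ 3 + c / a * x) = a * (y ^ 3 + c / a * y)" by simp
  then have eq: "a * x ^ 3 + c * x = a * y ^ 3 + c * y"
    using assms(2) by (simp add: distrib_left)
  show ?thesis
  proof (cases "x = 0 \<or> y = 0")
    case True
    with xy(1) eq show ?thesis by (auto simp: power3_eq_cube)
  next
    case False
    with xy(1) eq show ?thesis by blast
  qed
qed

section \<open>The cubic game outside characteristic three\<close>

lemma Nora_last_wins_3:
  assumes "mover first 3 = Nora" and three: "(3 :: 'a::{finite,field}) \<noteq> 0"
  shows "winning 3 first Nora ([] :: 'a history)"
proof (rule winning.other)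
  have first: "first = Wanda" using assms(1) by (cases first) (auto simp: mover_def)
  then show "mover first (length ([] :: 'a history)) \<noteq> Nora" by (simp add: mover_def)
  fix m :: "nat \<times> 'a" assume m: "legal_move 3 [] m"
  obtain i c where ic: "m = (i, c)" by fastforce
  have leg1: "legal_history 3 ([] @ [m])"
    unfolding legal_history_snoc using m by simp
  show "winning 3 first Nora ([] @ [m])"
  proof (cases "i = 0 \<or> i = 3")
    case True
    then show ?thesis
      by (intro Nora_one_extreme_played) (use first leg1 ic in \<open>auto simp: mover_def\<close>)
  next
    case False
    with m ic have i: "i = 1 \<or> i = 2" by (auto simp: legal_move_def)
    \<comment> \<open>Played at the other middle index, \<open>b\<close> makes exactly one middle
      coefficient vanish; Wanda then has to play an extreme one.\<close>
    define b :: 'a where "b = (if c = 0 then 1 else 0)"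
    have m2: "legal_move 3 ([] @ [m]) (3 - i, b)" using i ic by (auto simp: legal_move_def)
    show ?thesis
    proof (rule winning.own[OF _ _ m2], goal_cases)
      case 3
      show ?case
      proof (rule winning.other)
        fix m3 assume m3: "legal_move 3 (([] @ [m]) @ [(3 - i, b)]) m3"
        obtain j a where ja: "m3 = (j, a)" by fastforce
        let ?h = "(([] @ [m]) @ [(3 - i, b)]) @ [m3]"
        have j: "j = 0 \<or> j = 3" and a: "a \<noteq> 0"
          using m3 ja ic i by (auto simp: legal_move_def)
        have leg: "legal_history 3 ?h"
          unfolding legal_history_snoc[of _ _ m3] legal_history_snoc[of _ _ "(_, b)"]
          using leg1 m2 m3 by blast
        define a1 a2 where "a1 = (if i = 1 then c else b)" and "a2 = (if i = 1 then b else c)"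
        have val: "play_val ?h x = a1 * x + a2 * x ^ 2 + a * x ^ j" for x
          unfolding ic ja play_val_snoc a1_def a2_def using i by auto
        have one: "a1 = 0 \<and> a2 \<noteq> 0 \<or> a1 \<noteq> 0 \<and> a2 = 0"
          by (auto simp: a1_def a2_def b_def)
        have "(\<exists>x. x \<noteq> 0 \<and> play_val ?h x = 0) \<or>
          (\<exists>x y. x \<noteq> 0 \<and> y \<noteq> 0 \<and> x \<noteq> y \<and>
            play_val ?h x / x ^ (3 - j) = play_val ?h y / y ^ (3 - j))"
          using j
        proof
          assume j: "j = 3"
          show ?thesis
          proof (cases "a1 = 0")
            case True
            then have "play_val ?h (- a2 / a) = 0"
              unfolding val using j a by (simp add: field_simps power2_eq_square power3_eq_cube)
            moreover have "- a2 / a \<noteq> 0" using one True a by simp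
            ultimately show ?thesis by blast
          next
            case False
            with one have "a2 = 0" by blast
            then show ?thesis
              unfolding val using j cubic_not_inj[OF three a False] by (simp add: add.commute)
          qed
        next
          assume j: "j = 0"
          show ?thesis
          proof (cases "a1 = 0")
            case False
            with one have "play_val ?h (- a / a1) = 0" unfolding val using j by simp
            moreover have "- a / a1 \<noteq> 0" using False a by simp
            ultimately show ?thesis by blast
          next
            case True
            with one have "a2 \<noteq> 0" by blast
            \<comment> \<open>The substitution \<open>x = inverse y\<close> reverses the
              coefficients and turns \<open>a + a2 * x ^ 2\<close> into the cubic of
              \<open>cubic_not_inj\<close>.\<close>
            have inv: "play_val ?h (inverse y) = (a * y ^ 3 + a2 * y) / y ^ 3"
              "play_val ?h (inverse y) / inverse y ^ (3 - j) = a * y ^ 3 + a2 * y"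
              if "y \<noteq> 0" for y
              unfolding val using that j True
              by (simp_all add: field_simps power2_eq_square power3_eq_cube)
            from cubic_not_inj[OF three a \<open>a2 \<noteq> 0\<close>] show ?thesis
            proof (elim disjE exE conjE, goal_cases)
              case (1 y)
              then show ?case using inv(1)[of y] by (intro disjI1 exI[of _ "inverse y"]) simp
            next
              case (2 x y)
              then show ?case
                using inv(2)[of x] inv(2)[of y]
                by (intro disjI2 exI[of _ "inverse x"] exI[of _ "inverse y"]) simp
            qed
          qed
        qed
        then show "winning 3 first Nora ?h"
          by (intro Nora_final_extreme[where i = "3 - j"]) (use assms leg i j ic ja in auto)
      qed (use first in \<open>auto simp: mover_def\<close>)
    qed (use first in \<open>auto simp: mover_def\<close>)
  qed
qed simp

section \<open>Wanda in characteristic three\<close>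

text \<open>For \<open>i = 3\<close> the equation is solved in terms of \<open>inverse x\<close>.\<close>

lemma Wanda_forces_root:
  fixes h :: "'a::field history"
  assumes "legal_history 3 h" "length h = 3" "i = 0 \<or> i = 3" "i \<notin> indices h"
    and "mover first 3 \<noteq> Wanda"
    and val: "\<And>x. play_val h x = b * x ^ (if i = 0 then 1 else 2) + a * x ^ (3 - i)"
    and surj: "surj (\<lambda>x. a * x ^ 3 + b * x)"
  shows "winning 3 first Wanda h"
proof (rule winning.other)
  fix m assume m: "legal_move 3 h m"
  obtain j e where je: "m = (j, e)" by fastforce
  have leg: "legal_history 3 (h @ [m])" using assms(1) m by simp
  have "indices (h @ [m]) = {..3}"
    using complete_indices[OF leg] assms(2) by simp
  then have "i \<in> indices (h @ [m])" using assms(3) by auto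
  \<comment> \<open>Only the extreme index \<open>i\<close> is open, so Nora's last move is forced
    up to its nonzero value \<open>e\<close>; surjectivity supplies a root for every such
    \<open>e\<close>.\<close>
  then have j: "j = i" using assms(4) je by auto
  have e: "e \<noteq> 0" using m je j assms(3) by (auto simp: legal_move_def)
  obtain y where y: "a * y ^ 3 + b * y = - e" using surjD[OF surj, of "- e"] by auto
  have "\<exists>x. play_val (h @ [m]) x = 0"
  proof (cases "i = 0")
    case True
    then have "play_val (h @ [m]) y = 0"
      using y unfolding je play_val_snoc val j by (simp add: add.commute)
    then show ?thesis ..
  next
    case False
    have "y \<noteq> 0" using y e by auto
    then have "play_val (h @ [m]) (inverse y) = (a * y ^ 3 + b * y + e) / y ^ 3"
      using False assms(3) unfolding je play_val_snoc val j
      by (auto simp: field_simps power2_eq_square power3_eq_cube)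
    then have "play_val (h @ [m]) (inverse y) = 0" using y by simp
    then show ?thesis ..
  qed
  then show "winning 3 first Wanda (h @ [m])"
    using assms(2) by (intro winning.final) (auto simp: has_root_in_fract_field)
qed (use assms in auto)

text \<open>Cubing is additive here, so points with equal values differ by some \<open>t\<close>
  with \<open>t * (a * t ^ 2 + b) = 0\<close>. A nonzero \<open>t\<close> would make
  \<open>- b / a\<close> a square, so \<open>b = 0\<close> and then \<open>a * t ^ 2 = 0\<close>,
  which is impossible.\<close>

lemma surj_cube_plus_char3:
  fixes a b :: "'a::{finite,field}"
  assumes "(3 :: 'a) = 0" "a \<noteq> 0" "b = 0 \<or> (\<forall>s. s ^ 2 \<noteq> - b / a)"
  shows "surj (\<lambda>x. a * x ^ 3 + b * x)"
proof (rule finite_UNIV_inj_surj)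
  show "inj (\<lambda>x. a * x ^ 3 + b * x)"
  proof (rule injI, rule ccontr)
    fix x y assume eq: "a * x ^ 3 + b * x = a * y ^ 3 + b * y" and ne: "x \<noteq> y"
    let ?t = "x - y"
    have "?t ^ 3 = x ^ 3 - y ^ 3 - 3 * (x * y * ?t)"
      by (simp add: power3_eq_cube algebra_simps)
    then have cube: "?t ^ 3 = x ^ 3 - y ^ 3" using assms(1) by simp
    have "a * ?t ^ 3 + b * ?t = 0" unfolding cube using eq by (simp add: algebra_simps)
    then have "?t * (a * ?t ^ 2 + b) = 0" by (simp add: power2_eq_square power3_eq_cube algebra_simps)
    then have z: "a * ?t ^ 2 + b = 0" using ne by simp
    then have "?t ^ 2 = - b / a" using assms(2)
      by (metis add.commute add_eq_0_iff nonzero_mult_div_cancel_left)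
    then have "b = 0" using assms(3) by blast
    with z assms(2) ne show False by simp
  qed
qed simp

text \<open>1 and \<open>- 1\<close> are distinct with the same square, so squaring is not injective
  and, on a finite set, not surjective.\<close>

lemma ex_nonsquare:
  assumes "(2 :: 'a::{finite,field}) \<noteq> 0"
  shows "\<exists>n :: 'a. \<forall>s. s ^ 2 \<noteq> n"
proof (rule ccontr)
  assume "\<not> ?thesis"
  then have "surj (\<lambda>s :: 'a. s ^ 2)" by (metis surjI)
  then have "inj (\<lambda>s :: 'a. s ^ 2)" by (intro finite_UNIV_surj_inj) auto
  then have "(1 :: 'a) = - 1" by (rule injD) simp
  then have "(1 :: 'a) + 1 = 0" by (metis add.right_inverse)
  then show False using assms by simp
qed

lemma Wanda_wins_3_char3:
  assumes "mover first 3 \<noteq> Wanda" and three: "(3 :: 'a::{finite,field}) = 0"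
  shows "winning 3 first Wanda ([] :: 'a history)"
proof (rule winning.own[where m = "(1, 0)"])
  have first: "first = Wanda" using assms(1) by (cases first) (auto simp: mover_def)
  then show "mover first (length ([] :: 'a history)) = Wanda" by (simp add: mover_def)
  show "winning 3 first Wanda ([] @ [(1, 0 :: 'a)])"
  proof (rule winning.other)
    fix m :: "nat \<times> 'a" assume m: "legal_move 3 ([] @ [(1, 0)]) m"
    obtain i b where ib: "m = (i, b)" by fastforce
    let ?h = "([] @ [(1, 0)]) @ [(i, b)]"
    have i: "i = 0 \<or> i = 2 \<or> i = 3" using m ib by (auto simp: legal_move_def)
    have leg: "legal_history 3 ?h"
      unfolding legal_history_snoc using m ib by (auto simp: legal_move_def)
    \<comment> \<open>Wanda plays \<open>a\<close> at \<open>j\<close> and leaves the extreme index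
      \<open>k\<close> to Nora; \<open>a'\<close> and \<open>b'\<close> are the coefficients of the
      cubic map that must be surjective.\<close>
    have reply: "winning 3 first Wanda ?h"
      if mv: "legal_move 3 ?h (j, a)" and jk: "k = 0 \<or> k = 3" "k \<notin> indices (?h @ [(j, a)])"
        and val: "\<And>x. play_val (?h @ [(j, a)]) x = b' * x ^ (if k = 0 then 1 else 2) + a' * x ^ (3 - k)"
        and surj: "surj (\<lambda>x. a' * x ^ 3 + b' * x)" for j a k a' b'
    proof (rule winning.own[OF _ _ mv])
      show "winning 3 first Wanda (?h @ [(j, a)])"
        by (rule Wanda_forces_root[OF _ _ jk assms(1) val surj])
          (use leg mv legal_history_snoc[of 3 ?h "(j, a)"] in auto)
    qed (use first in \<open>auto simp: mover_def\<close>)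
    have "winning 3 first Wanda ?h"
      using i
    proof (elim disjE)
      assume i: "i = 0"
      then have "b \<noteq> 0" using m ib by (simp add: legal_move_def)
      show ?thesis
        \<comment> \<open>Clearing the last middle coefficient leaves \<open>b + e * x ^ 3\<close>,
          solvable for every \<open>e \<noteq> 0\<close> because cubing is bijective.\<close>
        by (rule reply[where j = 2 and a = 0 and k = 3 and b' = 0 and a' = b])
          (use i \<open>b \<noteq> 0\<close> surj_cube_plus_char3[OF three, of b 0] in
            \<open>auto simp: legal_move_def poly_of_play_def poly_monom\<close>)
    next
      assume i: "i = 3"
      then have "b \<noteq> 0" using m ib by (simp add: legal_move_def)
      show ?thesis
        by (rule reply[where j = 2 and a = 0 and k = 0 and b' = 0 and a' = b])
          (use i \<open>b \<noteq> 0\<close> surj_cube_plus_char3[OF three, of b 0] in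
            \<open>auto simp: legal_move_def poly_of_play_def poly_monom\<close>)
    next
      assume i: "i = 2"
      have "(2 :: 'a) \<noteq> 0"
      proof
        assume "(2 :: 'a) = 0"
        then have "(3 :: 'a) - 2 = 0" using three by simp
        then show False by simp
      qed
      then obtain n :: 'a where n: "\<forall>s. s ^ 2 \<noteq> n" using ex_nonsquare by blast
      then have "n \<noteq> 0" by (metis zero_power2)
      \<comment> \<open>Chosen so that \<open>- b / a\<close> is the nonsquare \<open>n\<close> when
        \<open>b \<noteq> 0\<close>; when \<open>b = 0\<close> the value 1 serves.\<close>
      define a where "a = (if b = 0 then 1 else - b / n)"
      have "a \<noteq> 0" using \<open>n \<noteq> 0\<close> by (simp add: a_def)
      have "b = 0 \<or> (\<forall>s. s ^ 2 \<noteq> - b / a)" using n \<open>n \<noteq> 0\<close> by (auto simp: a_def)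
      note surj = surj_cube_plus_char3[OF three \<open>a \<noteq> 0\<close> this]
      show ?thesis
        by (rule reply[where j = 0 and a = a and k = 3 and b' = b and a' = a])
          (use i \<open>a \<noteq> 0\<close> surj in \<open>auto simp: legal_move_def poly_of_play_def poly_monom\<close>)
    qed
    then show "winning 3 first Wanda (([] @ [(1, 0)]) @ [m])" using ib by simp
  qed (use first in \<open>auto simp: mover_def\<close>)
qed (auto simp: legal_move_def)

lemma three_eq_0_iff_CHAR: "(3 :: 'a::field) = 0 \<longleftrightarrow> CHAR('a) = 3"
proof -
  have "(3 :: 'a) = 0 \<longleftrightarrow> CHAR('a) dvd 3"
    using of_nat_eq_0_iff_char_dvd[of 3, where 'a = 'a] by simp
  also have "\<dots> \<longleftrightarrow> CHAR('a) = 3"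
    using CHAR_not_1[where 'a = 'a] prime_nat_iff[of 3] by auto
  finally show ?thesis .
qed

theorem theorem9p1:
  fixes d :: nat and first :: player
  assumes "d \<ge> 2"
  shows "(d \<ge> 4 \<or> d = 2 \<longrightarrow>
            has_winning_strategy TYPE('a::{finite,field}) d first (mover first d))
       \<and> (d = 3 \<and> CHAR('a) = 3 \<longrightarrow> has_winning_strategy TYPE('a) d first Wanda)
       \<and> (d = 3 \<and> CHAR('a) \<noteq> 3 \<longrightarrow>
            has_winning_strategy TYPE('a) d first (mover first d))"
proof -
  have W: "has_winning_strategy TYPE('a) d first Wanda" if "mover first d = Wanda"
    by (rule winning_imp_has_winning_strategy) (rule Wanda_last_wins[OF assms that])
  have N: "has_winning_strategy TYPE('a) d first Nora"
    if "mover first d = Nora" "d \<noteq> 3 \<or> CHAR('a) \<noteq> 3"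
  proof (rule winning_imp_has_winning_strategy)
    have "d = 2 \<or> d = 3 \<or> d \<ge> 4" using assms by linarith
    then show "winning d first Nora ([] :: 'a history)"
      using that Nora_last_wins Nora_last_wins_2 Nora_last_wins_3 three_eq_0_iff_CHAR[where 'a = 'a]
      by metis
  qed
  \<comment> \<open>\<open>W\<close> settles the case where Wanda moves last, and
    \<open>Wanda_wins_3_char3\<close> the other one.\<close>
  have "has_winning_strategy TYPE('a) d first Wanda" if "d = 3" "CHAR('a) = 3"
    using W Wanda_wins_3_char3[of first, where 'a = 'a] that three_eq_0_iff_CHAR[where 'a = 'a]
      winning_imp_has_winning_strategy by metis
  then show ?thesis using W N by (cases "mover first d") auto
qed

end
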